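(* Let $X$ be a zero-dimensional Hausdorff almost $P$-space and let $A_c(X)$ be a ring with $C_c^*(X)\subseteq A_c(X)\subseteq C_c(X)$. Then the following three statements are equivalent: (1) Each maximal ideal of $A_c(X)$ is a $z^0$-ideal. (2) Each $z$-ideal of $A_c(X)$ is a $z^0$-ideal. (3) $A_c(X)=C_c(X)$.
   Context: A space is zero-dimensional if its clopen sets form a base for its topology. $C_c(X)$ is the ring of real-valued continuous functions on $X$ with countable range, and $C_c^*(X)$ is the subring of bounded members of $C_c(X)$. $X$ is an almost $P$-space if every nonempty zero set $Z(f)=\{x: f(x)=0\}$, $f$ a real-valued continuous function on $X$, has nonempty interior. Ideals are always proper. For a commutative reduced ring $R$ with unity and $a\in R$, let $M_a$ be the intersection of all maximal ideals of $R$ containing $a$, and $\mathcal P_a$ the intersection of all minimal prime ideals of $R$ containing $a$ (an empty intersection being $R$). An ideal $I$ of $R$ is a $z$-ideal if $M_a\subseteq I$ for every $a\in I$, and a $z^0$-ideal if $\mathcal P_a\subseteq I$ for every $a\in I$. *)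

theory Defs
  imports "HOL-Analysis.Analysis" "HOL-Algebra.Subrings"
begin

definition zero_dimensional_space :: "'a topology \<Rightarrow> bool" where
  "zero_dimensional_space X \<longleftrightarrow>
     (\<forall>U x. openin X U \<and> x \<in> U \<longrightarrow>
        (\<exists>V. openin X V \<and> closedin X V \<and> x \<in> V \<and> V \<subseteq> U))"

definition zero_set :: "'a topology \<Rightarrow> ('a \<Rightarrow> real) \<Rightarrow> 'a set" where
  "zero_set X f = {x \<in> topspace X. f x = 0}"

definition almost_P_space :: "'a topology \<Rightarrow> bool" where
  "almost_P_space X \<longleftrightarrow>
     (\<forall>f. continuous_map X euclideanreal f \<and> zero_set X f \<noteq> {} \<longrightarrow>
        X interior_of (zero_set X f) \<noteq> {})"

text \<open>
  A function on the space is represented by its extensional representative, which is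
  \<^const>\<open>undefined\<close> off \<^term>\<open>topspace X\<close>, so that equality of functions is equality on the space.
\<close>

definition Cc :: "'a topology \<Rightarrow> ('a \<Rightarrow> real) set" where
  "Cc X = {f \<in> extensional (topspace X).
             continuous_map X euclideanreal f \<and> countable (f ` topspace X)}"

definition Cc_bdd :: "'a topology \<Rightarrow> ('a \<Rightarrow> real) set" where
  "Cc_bdd X = {f \<in> Cc X. bounded (f ` topspace X)}"

definition Cc_ring :: "'a topology \<Rightarrow> ('a \<Rightarrow> real) ring" where
  "Cc_ring X = \<lparr>carrier = Cc X,
     mult = (\<lambda>f g. \<lambda>x\<in>topspace X. f x * g x), one = (\<lambda>x\<in>topspace X. 1),
     zero = (\<lambda>x\<in>topspace X. 0), add = (\<lambda>f g. \<lambda>x\<in>topspace X. f x + g x)\<rparr>"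

definition minimal_primeideal :: "'a set \<Rightarrow> ('a, 'b) ring_scheme \<Rightarrow> bool" where
  "minimal_primeideal P R \<longleftrightarrow>
     primeideal P R \<and> (\<forall>Q. primeideal Q R \<and> Q \<subseteq> P \<longrightarrow> Q = P)"

text \<open>
  Intersecting with the carrier makes an empty intersection the whole ring rather than
  the universal set of the type.
\<close>

definition maximal_hull :: "('a, 'b) ring_scheme \<Rightarrow> 'a \<Rightarrow> 'a set" where
  "maximal_hull R a = carrier R \<inter> \<Inter> {M. maximalideal M R \<and> a \<in> M}"

definition minimal_prime_hull :: "('a, 'b) ring_scheme \<Rightarrow> 'a \<Rightarrow> 'a set" where
  "minimal_prime_hull R a = carrier R \<inter> \<Inter> {P. minimal_primeideal P R \<and> a \<in> P}"

definition z_ideal :: "'a set \<Rightarrow> ('a, 'b) ring_scheme \<Rightarrow> bool" where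
  "z_ideal I R \<longleftrightarrow> ideal I R \<and> I \<noteq> carrier R \<and> (\<forall>a\<in>I. maximal_hull R a \<subseteq> I)"

definition z0_ideal :: "'a set \<Rightarrow> ('a, 'b) ring_scheme \<Rightarrow> bool" where
  "z0_ideal I R \<longleftrightarrow> ideal I R \<and> I \<noteq> carrier R \<and> (\<forall>a\<in>I. minimal_prime_hull R a \<subseteq> I)"

lemma cring_Cc_ring: "cring (Cc_ring X)"
proof -
  have comb: "(\<lambda>x\<in>topspace X. h (f x) (g x)) \<in> Cc X"
    if "f \<in> Cc X" "g \<in> Cc X" "continuous_map X euclideanreal (\<lambda>x. h (f x) (g x))"
    for f g and h :: "real \<Rightarrow> real \<Rightarrow> real"
  proof -
    have "(\<lambda>x. h (f x) (g x)) ` topspace X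
            \<subseteq> (\<lambda>(u, v). h u v) ` (f ` topspace X \<times> g ` topspace X)"
      by auto
    moreover have "countable ((\<lambda>(u, v). h u v) ` (f ` topspace X \<times> g ` topspace X))"
      using that by (simp add: Cc_def)
    ultimately have "countable ((\<lambda>x. h (f x) (g x)) ` topspace X)"
      by (rule countable_subset)
    moreover have "continuous_map X euclideanreal (\<lambda>x\<in>topspace X. h (f x) (g x))"
      using that(3) by (rule continuous_map_eq) simp
    ultimately show ?thesis by (simp add: Cc_def)
  qed
  have const: "(\<lambda>x\<in>topspace X. c) \<in> Cc X" for c :: real
  proof -
    have "continuous_map X euclideanreal (\<lambda>x\<in>topspace X. c)"
      by (rule continuous_map_eq[of _ _ "\<lambda>x. c"]) auto
    then show ?thesis by (simp add: Cc_def image_constant_conv)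
  qed
  have cont: "f \<in> Cc X \<Longrightarrow> continuous_map X euclideanreal f" for f
    by (simp add: Cc_def)
  have ext: "f \<in> Cc X \<Longrightarrow> f \<in> extensional (topspace X)" for f
    by (simp add: Cc_def)
  have add: "(\<lambda>x\<in>topspace X. f x + g x) \<in> Cc X" if "f \<in> Cc X" "g \<in> Cc X" for f g
    using that by (intro comb continuous_map_add cont)
  have mult: "(\<lambda>x\<in>topspace X. f x * g x) \<in> Cc X" if "f \<in> Cc X" "g \<in> Cc X" for f g
    using that by (intro comb continuous_map_real_mult cont)
  show ?thesis
  proof (rule cringI)
    show "abelian_group (Cc_ring X)"
    proof (rule abelian_groupI)
      fix f assume f: "f \<in> carrier (Cc_ring X)"
      have "(\<lambda>x\<in>topspace X. (\<lambda>x\<in>topspace X. -1) x * f x) \<in> Cc X"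
        using mult[OF const, of f "-1"] f unfolding Cc_ring_def by (auto cong: restrict_cong)
      then show "\<exists>g\<in>carrier (Cc_ring X). g \<oplus>\<^bsub>Cc_ring X\<^esub> f = \<zero>\<^bsub>Cc_ring X\<^esub>"
        by (rule_tac bexI) (auto simp: Cc_ring_def restrict_def fun_eq_iff)
    qed (auto simp: Cc_ring_def add const algebra_simps ext
              intro!: extensionalityI[of _ "topspace X"])
    show "Group.comm_monoid (Cc_ring X)"
      by (rule comm_monoidI)
        (auto simp: Cc_ring_def mult const algebra_simps ext
              intro!: extensionalityI[of _ "topspace X"])
  qed (auto simp: Cc_ring_def fun_eq_iff algebra_simps)
qed

end

theory Submission
  imports Defs "HOL-Algebra.Ring_Divisibility"
begin

text \<open>
  Every element \<open>g\<close> of a minimal prime is annihilated by an element outside that prime, up to a power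
  of \<open>g\<close>, so a function without zeros lies in no minimal prime and \<open>\<P>\<^sub>g\<close> is the whole ring.  For \<open>f\<close> in
  \<open>C\<^sub>c(X)\<close> the bounded function \<open>g = 1 / (1 + f\<^sup>2)\<close> has no zeros. If the maximal ideals are
  \<open>z\<^sup>0\<close>-ideals, \<open>g\<close> is thus a unit, and \<open>f = (f / (1 + f\<^sup>2)) (1 + f\<^sup>2)\<close> lies in \<open>A\<^sub>c(X)\<close>.

  Conversely, a minimal prime below the point ideal at \<open>x \<in> int Z(a)\<close> contains \<open>a\<close>, because it misses the
  indicator of a clopen neighbourhood of \<open>x\<close> inside \<open>Z(a)\<close>; hence \<open>b \<in> \<P>\<^sub>a\<close> vanishes on
  \<open>int Z(a)\<close>.  In an almost \<open>P\<close>-space this set is dense in \<open>Z(a)\<close>, so \<open>Z(a) \<subseteq> Z(b)\<close>. If a maximal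
  ideal \<open>M\<close> of \<open>C\<^sub>c(X)\<close> contains \<open>a\<close> but not \<open>b\<close>, write \<open>1 = m + r b\<close> with \<open>m \<in> M\<close>; then
  \<open>a\<^sup>2 + m\<^sup>2 \<in> M\<close> has no zeros and is a unit.
\<close>

section \<open>Prime ideals\<close>

context cring
begin

text \<open>Zorn's lemma, since the union of a chain of ideals missing \<open>S\<close> is again
  one. The set \<open>S\<close> is arbitrary: a multiplicative set yields prime ideals,
  \<open>{\<one>}\<close> yields maximal ideals.\<close>

lemma maximal_avoiding_ideal_exists:
  assumes "ideal I R" "I \<inter> S = {}"
  obtains Q where "ideal Q R" "I \<subseteq> Q" "Q \<inter> S = {}"
    "\<And>J. ideal J R \<Longrightarrow> Q \<subseteq> J \<Longrightarrow> J \<inter> S = {} \<Longrightarrow> J = Q"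
proof -
  let ?F = "{J. ideal J R \<and> I \<subseteq> J \<and> J \<inter> S = {}}"
  have "\<exists>Q\<in>?F. \<forall>J\<in>?F. Q \<subseteq> J \<longrightarrow> J = Q"
  proof (rule subset_Zorn_nonempty)
    show "?F \<noteq> {}" using assms by blast
  next
    fix C assume C: "C \<noteq> {}" "subset.chain ?F C"
    have "subset.chain {J. ideal J R} C"
      using C(2) by (auto simp: subset_chain_def)
    from chain_Union_is_ideal[OF this] C(1) have "ideal (\<Union>C) R" by simp
    then show "\<Union>C \<in> ?F" using C by (fastforce simp: subset_chain_def)
  qed
  then show ?thesis using that by (smt (verit) mem_Collect_eq subset_trans)
qed

text \<open>Tool for maximality arguments: enlarge \<open>Q\<close> by one element \<open>x\<close>
  and write the members of the larger ideal explicitly.\<close>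

lemma ideal_adjoin:
  assumes "ideal Q R" "x \<in> carrier R"
  shows "ideal (Q <+>\<^bsub>R\<^esub> PIdl x) R" "Q \<subseteq> Q <+>\<^bsub>R\<^esub> PIdl x" "x \<in> Q <+>\<^bsub>R\<^esub> PIdl x"
    "\<And>y. y \<in> Q <+>\<^bsub>R\<^esub> PIdl x \<Longrightarrow> \<exists>q\<in>Q. \<exists>r\<in>carrier R. y = q \<oplus> r \<otimes> x"
proof -
  interpret Q: ideal Q R by fact
  show "ideal (Q <+>\<^bsub>R\<^esub> PIdl x) R"
    using assms by (intro add_ideals cgenideal_ideal)
  have z: "\<zero> \<in> PIdl x"
    using assms(2) cgenideal_ideal by (simp add: additive_subgroup.zero_closed ideal.axioms(1))
  show "Q \<subseteq> Q <+>\<^bsub>R\<^esub> PIdl x"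
  proof
    fix q assume q: "q \<in> Q"
    then have "q = q \<oplus> \<zero>" by simp
    with q z show "q \<in> Q <+>\<^bsub>R\<^esub> PIdl x" unfolding set_add_def' by blast
  qed
  have "x = \<zero> \<oplus> x" using assms by simp
  then show "x \<in> Q <+>\<^bsub>R\<^esub> PIdl x"
    using cgenideal_self[OF assms(2)] Q.zero_closed unfolding set_add_def' by blast
  show "\<And>y. y \<in> Q <+>\<^bsub>R\<^esub> PIdl x \<Longrightarrow> \<exists>q\<in>Q. \<exists>r\<in>carrier R. y = q \<oplus> r \<otimes> x"
    unfolding set_add_def' cgenideal_def by blast
qed

text \<open>Krull's argument: an ideal maximal among those disjoint from a multiplicative set is
  prime, because adjoining any outside element forces it to meet the set.\<close>

lemma prime_avoiding_exists:
  assumes S: "S \<subseteq> carrier R" "S \<noteq> {}" "\<And>s t. s \<in> S \<Longrightarrow> t \<in> S \<Longrightarrow> s \<otimes> t \<in> S" "\<zero> \<notin> S"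
  obtains Q where "primeideal Q R" "Q \<inter> S = {}"
proof -
  obtain Q where Q: "ideal Q R" "Q \<inter> S = {}"
    "\<And>J. ideal J R \<Longrightarrow> Q \<subseteq> J \<Longrightarrow> J \<inter> S = {} \<Longrightarrow> J = Q"
    using maximal_avoiding_ideal_exists[OF zeroideal, of S] S(4) by (metis disjoint_iff singletonD)
  interpret Q: ideal Q R by fact
  have meet: "\<exists>q\<in>Q. \<exists>r\<in>carrier R. q \<oplus> r \<otimes> x \<in> S" if "x \<in> carrier R" "x \<notin> Q" for x
    using Q(3)[OF ideal_adjoin(1,2)[OF Q(1) that(1)]] ideal_adjoin(3,4)[OF Q(1) that(1)] that(2)
    by (metis disjoint_iff)
  have "primeideal Q R"
  proof (rule primeidealI)
    show "carrier R \<noteq> Q" using S Q(2) by blast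
    fix x y assume xy: "x \<in> carrier R" "y \<in> carrier R" "x \<otimes> y \<in> Q"
    show "x \<in> Q \<or> y \<in> Q"
    proof (rule ccontr)
      assume "\<not> (x \<in> Q \<or> y \<in> Q)"
      then obtain p r q s where *: "p \<in> Q" "r \<in> carrier R" "p \<oplus> r \<otimes> x \<in> S"
        "q \<in> Q" "s \<in> carrier R" "q \<oplus> s \<otimes> y \<in> S"
        using meet xy by metis
      have pq: "p \<in> carrier R" "q \<in> carrier R" using * Q.Icarr by auto
      \<comment> \<open>Each summand of the expansion has a factor \<open>p\<close>,
        \<open>q\<close> or \<open>x \<otimes> y\<close>, all in \<open>Q\<close>, whereas a product
        of two elements of \<open>S\<close> stays in \<open>S\<close>.\<close>
      have "(p \<oplus> r \<otimes> x) \<otimes> (q \<oplus> s \<otimes> y)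
          = p \<otimes> (q \<oplus> s \<otimes> y) \<oplus> (r \<otimes> x \<otimes> q \<oplus> r \<otimes> s \<otimes> (x \<otimes> y))"
        using pq * xy by algebra
      also have "\<dots> \<in> Q"
        using * pq xy by (intro Q.a_closed Q.I_l_closed[of "x \<otimes> y"] Q.I_l_closed[of q] Q.I_r_closed[of p]) auto
      finally show False using S(3) * Q(2) by blast
    qed
  qed (use Q is_cring in auto)
  then show ?thesis using Q(2) that by blast
qed

text \<open>An ideal is proper exactly when it misses \<open>\<one>\<close>, so avoiding
  \<open>{\<one>}\<close> maximally means being a maximal ideal.\<close>

lemma maximalideal_exists:
  assumes "ideal I R" "I \<noteq> carrier R"
  obtains M where "maximalideal M R" "I \<subseteq> M"
proof -
  have "I \<inter> {\<one>} = {}" using assms ideal.one_imp_carrier by blast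
  then obtain M where M: "ideal M R" "I \<subseteq> M" "M \<inter> {\<one>} = {}"
    "\<And>J. ideal J R \<Longrightarrow> M \<subseteq> J \<Longrightarrow> J \<inter> {\<one>} = {} \<Longrightarrow> J = M"
    using maximal_avoiding_ideal_exists[OF assms(1)] by metis
  have "maximalideal M R"
  proof (rule maximalidealI)
    show "J = M \<or> J = carrier R" if "ideal J R" "M \<subseteq> J" for J
      using M(4)[OF that] ideal.one_imp_carrier[OF that(1)] by blast
  qed (use M in auto)
  then show ?thesis using M(2) that by blast
qed

text \<open>Intersections of nonempty chains of primes are prime. Taking complements reverses
  inclusion, so the upward form of Zorn's lemma delivers a minimal element.\<close>

lemma minimal_prime_below:
  assumes "primeideal P R"
  obtains Q where "minimal_primeideal Q R" "Q \<subseteq> P"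
proof -
  let ?F = "uminus ` {Q. primeideal Q R \<and> Q \<subseteq> P}"
  have "\<exists>M\<in>?F. \<forall>X\<in>?F. M \<subseteq> X \<longrightarrow> X = M"
  proof (rule subset_Zorn_nonempty)
    show "?F \<noteq> {}" using assms by blast
  next
    fix C assume C: "C \<noteq> {}" "subset.chain ?F C"
    let ?D = "uminus ` C"
    have D: "?D \<noteq> {}" "\<And>Q. Q \<in> ?D \<Longrightarrow> primeideal Q R \<and> Q \<subseteq> P"
      "\<And>Q Q'. Q \<in> ?D \<Longrightarrow> Q' \<in> ?D \<Longrightarrow> Q \<subseteq> Q' \<or> Q' \<subseteq> Q"
      using C by (auto simp: subset_chain_def subset_iff image_iff) blast+
    have "primeideal (\<Inter>?D) R"
    proof (rule primeidealI)
      show "ideal (\<Inter>?D) R"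
        using D by (intro i_Intersect) (auto dest: primeideal.axioms(1))
      obtain Q where "Q \<in> ?D" using D(1) by blast
      then show "carrier R \<noteq> \<Inter>?D"
        using D(2) primeideal.I_notcarr ideal.Icarr primeideal.axioms(1)
        by (metis InterE subsetI subset_antisym)
      fix a b assume ab: "a \<in> carrier R" "b \<in> carrier R" "a \<otimes> b \<in> \<Inter>?D"
      have *: "a \<in> Q \<or> b \<in> Q" if "Q \<in> ?D" for Q
        using D(2)[OF that] ab that by (meson InterD primeideal.I_prime)
      show "a \<in> \<Inter>?D \<or> b \<in> \<Inter>?D"
      proof (rule ccontr)
        assume "\<not> (a \<in> \<Inter>?D \<or> b \<in> \<Inter>?D)"
        \<comment> \<open>The smaller of the two comparable primes contains neither \<open>a\<close>
          nor \<open>b\<close>, against its primality.\<close>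
        then obtain Q Q' where "Q \<in> ?D" "a \<notin> Q" "Q' \<in> ?D" "b \<notin> Q'" by blast
        then show False using D(3)[of Q Q'] *[of Q] *[of Q'] by blast
      qed
    qed (rule is_cring)
    moreover have "\<Inter>?D \<subseteq> P" using D by blast
    moreover have "\<Union>C = - \<Inter>?D" by auto
    ultimately show "\<Union>C \<in> ?F" by blast
  qed
  then obtain Q where Q: "primeideal Q R" "Q \<subseteq> P"
    "\<And>Q'. primeideal Q' R \<Longrightarrow> Q' \<subseteq> P \<Longrightarrow> Q' \<subseteq> Q \<Longrightarrow> - Q' = - Q"
    by (auto simp: image_iff)
  then have "minimal_primeideal Q R"
    unfolding minimal_primeideal_def by (metis double_complement order_trans)
  then show ?thesis using Q(2) that by blast
qed

text \<open>Otherwise the products of elements outside \<open>P\<close> with powers of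
  \<open>g\<close> form a multiplicative set without \<open>\<zero>\<close>. A prime avoiding it
  lies inside \<open>P\<close> and misses \<open>g\<close>, contradicting minimality.\<close>

lemma minimal_prime_annihilator:
  assumes P: "minimal_primeideal P R" and g: "g \<in> P"
  shows "\<exists>c\<in>carrier R - P. \<exists>n::nat. c \<otimes> g [^] n = \<zero>"
proof (rule ccontr)
  assume contra: "\<not> ?thesis"
  interpret P: primeideal P R using P by (simp add: minimal_primeideal_def)
  have gR: "g \<in> carrier R" using g P.Icarr by blast
  let ?S = "{c \<otimes> g [^] n | c (n::nat). c \<in> carrier R \<and> c \<notin> P}"
  have one: "\<one> \<notin> P" using P.I_notcarr P.one_imp_carrier by auto
  obtain Q where Q: "primeideal Q R" "Q \<inter> ?S = {}"
  proof (rule prime_avoiding_exists)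
    show "?S \<subseteq> carrier R" using gR by auto
    show "?S \<noteq> {}" using one by auto
    show "\<zero> \<notin> ?S" using contra by force
    fix s t assume "s \<in> ?S" "t \<in> ?S"
    then obtain c m d n where cd: "c \<in> carrier R" "c \<notin> P" "d \<in> carrier R" "d \<notin> P"
      and st: "s = c \<otimes> g [^] (m::nat)" "t = d \<otimes> g [^] (n::nat)" by blast
    have "s \<otimes> t = c \<otimes> d \<otimes> (g [^] m \<otimes> g [^] n)"
      using gR cd st by (simp add: m_ac)
    also have "\<dots> = c \<otimes> d \<otimes> g [^] (m + n)"
      using gR by (simp add: nat_pow_mult)
    finally have "s \<otimes> t = c \<otimes> d \<otimes> g [^] (m + n)" .
    moreover have "c \<otimes> d \<in> carrier R" "c \<otimes> d \<notin> P"
      using P.I_prime[of c d] cd by auto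
    ultimately show "s \<otimes> t \<in> ?S" by blast
  qed
  interpret Q: primeideal Q R by fact
  \<comment> \<open>Exponent 0 puts every element outside \<open>P\<close> into
    \<open>?S\<close>.\<close>
  have "Q \<subseteq> P"
  proof
    fix q assume q: "q \<in> Q"
    then have "q \<in> carrier R" using Q.Icarr by blast
    moreover from this have "q = q \<otimes> g [^] (0::nat)" by simp
    ultimately show "q \<in> P" using Q(2) q by blast
  qed
  then have "Q = P" using P Q by (simp add: minimal_primeideal_def)
  \<comment> \<open>Exponent 1 with coefficient \<open>\<one>\<close>, which lies outside the proper
    ideal \<open>P\<close>.\<close>
  moreover have "g \<in> ?S"
  proof -
    have "\<one> \<otimes> g [^] (1::nat) \<in> ?S" using one one_closed by blast
    then show ?thesis using gR by simp
  qed
  ultimately show False using Q(2) g by blast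
qed

end

section \<open>Functions with countable range\<close>

text \<open>Asking for continuity only on the range of \<open>f\<close> lets \<open>h\<close> be the
  reciprocal when \<open>f\<close> has no zeros.\<close>

lemma Cc_compose:
  assumes "f \<in> Cc X" "continuous_on (f ` topspace X) h"
  shows "(\<lambda>x\<in>topspace X. h (f x)) \<in> Cc X"
proof -
  have "continuous_map X (top_of_set (f ` topspace X)) f"
    using assms(1) by (auto simp: Cc_def continuous_map_in_subtopology)
  moreover have "continuous_map (top_of_set (f ` topspace X)) euclideanreal h"
    using assms(2) by simp
  ultimately have "continuous_map X euclideanreal (h \<circ> f)"
    by (rule continuous_map_compose)
  then have "continuous_map X euclideanreal (\<lambda>x\<in>topspace X. h (f x))"
    by (rule continuous_map_eq) simp
  moreover have "(\<lambda>x\<in>topspace X. h (f x)) ` topspace X = h ` f ` topspace X" by auto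
  ultimately show ?thesis using assms(1) by (simp add: Cc_def)
qed

lemma clopen_indicator_in_Cc_bdd:
  assumes "openin X V" "closedin X V"
  shows "(\<lambda>x\<in>topspace X. if x \<in> V then 1 else 0) \<in> Cc_bdd X" (is "?f \<in> _")
proof -
  have "openin X {x \<in> topspace X. ?f x \<in> U}" for U :: "real set"
  proof -
    have "{x \<in> topspace X. ?f x \<in> U}
      = (if 1 \<in> U then V else {}) \<union> (if 0 \<in> U then topspace X - V else {})"
      using openin_subset[OF assms(1)] by auto
    then show ?thesis using assms by (auto simp: closedin_def)
  qed
  then have "continuous_map X euclideanreal ?f" by (simp add: continuous_map)
  moreover have "finite (?f ` topspace X)"
    by (rule finite_subset[of _ "{0, 1}"]) auto
  ultimately show ?thesis
    by (simp add: Cc_bdd_def Cc_def countable_finite finite_imp_bounded)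
qed

lemma Cc_bounded_compose:
  assumes "f \<in> Cc X" "continuous_on UNIV h" "\<And>t. \<bar>h t\<bar> \<le> B"
  shows "(\<lambda>x\<in>topspace X. h (f x)) \<in> Cc_bdd X"
proof -
  have "(\<lambda>x\<in>topspace X. h (f x)) \<in> Cc X"
    using assms(1,2) by (intro Cc_compose) (auto intro: continuous_on_subset)
  then show ?thesis
    using assms(3) by (auto simp: Cc_bdd_def bounded_iff)
qed

lemma Cc_ring_simps [simp]:
  "carrier (Cc_ring X) = Cc X"
  "f \<otimes>\<^bsub>Cc_ring X\<^esub> g = (\<lambda>x\<in>topspace X. f x * g x)" "\<one>\<^bsub>Cc_ring X\<^esub> = (\<lambda>x\<in>topspace X. 1)"
  "f \<oplus>\<^bsub>Cc_ring X\<^esub> g = (\<lambda>x\<in>topspace X. f x + g x)" "\<zero>\<^bsub>Cc_ring X\<^esub> = (\<lambda>x\<in>topspace X. 0)"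
  by (simp_all add: Cc_ring_def)

section \<open>Rings between \<open>Cc_bdd X\<close> and \<open>Cc X\<close>\<close>

locale intermediate_ring =
  fixes X :: "'a topology" and A :: "('a \<Rightarrow> real) set"
  assumes subring_A: "subring A (Cc_ring X)" and bdd_subset: "Cc_bdd X \<subseteq> A" and subset_Cc: "A \<subseteq> Cc X"
begin

abbreviation R where "R \<equiv> (Cc_ring X)\<lparr>carrier := A\<rparr>"

sublocale cring R
proof -
  interpret C: cring "Cc_ring X" by (rule cring_Cc_ring)
  show "cring R"
    using C.subcring_iff[of A] C.subcringI'[OF subring_A] subset_Cc by (simp add: Cc_ring_def)
qed

lemma A_ext: "f \<in> A \<Longrightarrow> f \<in> extensional (topspace X)"
  using subset_Cc by (auto simp: Cc_def)

lemma A_mult: "f \<in> A \<Longrightarrow> g \<in> A \<Longrightarrow> (\<lambda>x\<in>topspace X. f x * g x) \<in> A"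
  using m_closed[of f g] by simp

lemma A_add: "f \<in> A \<Longrightarrow> g \<in> A \<Longrightarrow> (\<lambda>x\<in>topspace X. f x + g x) \<in> A"
  using a_closed[of f g] by simp

lemma power_apply: "x \<in> topspace X \<Longrightarrow> (f [^]\<^bsub>R\<^esub> (n::nat)) x = f x ^ n"
  by (induction n) (simp_all add: mult.commute)

text \<open>This is the kernel of evaluation at \<open>x\<close>, and the reals are an integral
  domain. It supplies a prime below which a minimal prime can be chosen.\<close>

lemma point_primeideal:
  assumes x: "x \<in> topspace X"
  shows "primeideal {f \<in> A. f x = 0} R"
proof (rule primeidealI2)
  show "additive_subgroup {f \<in> A. f x = 0} R"
  proof (rule additive_subgroupI)
    show "subgroup {f \<in> A. f x = 0} (add_monoid R)"
    proof (rule add.subgroupI)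
      show "{f \<in> A. f x = 0} \<noteq> {}"
        using zero_closed x by force
      fix f assume f: "f \<in> {f \<in> A. f x = 0}"
      then have *: "\<ominus>\<^bsub>R\<^esub> f \<in> A" using a_inv_closed[of f] by simp
      have "(\<ominus>\<^bsub>R\<^esub> f \<oplus>\<^bsub>R\<^esub> f) x = \<zero>\<^bsub>R\<^esub> x"
        using f l_neg[of f] by simp
      then show "\<ominus>\<^bsub>R\<^esub> f \<in> {f \<in> A. f x = 0}" using f x * by simp
    qed (use x A_add in auto)
  qed
  show "carrier R \<noteq> {f \<in> A. f x = 0}"
    using one_closed x by force
qed (use x A_mult is_cring in auto)

lemma minimal_prime_hull_vanishes:
  assumes zd: "zero_dimensional_space X" and a: "a \<in> A" and b: "b \<in> minimal_prime_hull R a"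
    and x: "x \<in> X interior_of zero_set X a"
  shows "b x = 0"
proof (rule ccontr)
  assume nz: "b x \<noteq> 0"
  obtain V where V: "openin X V" "closedin X V" "x \<in> V" "V \<subseteq> X interior_of zero_set X a"
    using zd x unfolding zero_dimensional_space_def by (meson openin_interior_of)
  then have Va: "\<And>y. y \<in> V \<Longrightarrow> y \<in> topspace X \<and> a y = 0"
    using interior_of_subset[of X "zero_set X a"] by (auto simp: zero_set_def)
  define e where "e = (\<lambda>x\<in>topspace X. if x \<in> V then 1 else 0 :: real)"
  have e: "e \<in> A" using clopen_indicator_in_Cc_bdd[OF V(1,2)] bdd_subset by (auto simp: e_def)
  obtain Q where Q: "minimal_primeideal Q R" "Q \<subseteq> {f \<in> A. f x = 0}"
    using minimal_prime_below[OF point_primeideal[of x]] Va[OF V(3)] by blast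
  interpret Q: primeideal Q R using Q(1) by (simp add: minimal_primeideal_def)
  \<comment> \<open>\<open>e\<close> is supported on \<open>V\<close>, where \<open>a\<close>
    vanishes; as \<open>e x = 1\<close>, it is \<open>a\<close> that primality places in
    \<open>Q\<close>.\<close>
  have "e \<otimes>\<^bsub>R\<^esub> a = \<zero>\<^bsub>R\<^esub>" using Va by (auto simp: e_def fun_eq_iff)
  then have "e \<otimes>\<^bsub>R\<^esub> a \<in> Q" using Q.zero_closed by metis
  moreover have "e \<notin> Q" using Q(2) Va V(3) by (auto simp: e_def)
  ultimately have "a \<in> Q" using Q.I_prime e a by auto
  then have "b \<in> Q" using b Q(1) by (auto simp: minimal_prime_hull_def)
  then show False using Q(2) nz by blast
qed

text \<open>The interior of the zero set of \<open>a\<close> is dense in that zero set: every clopen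
  \<open>V\<close> around one of its points meets the interior. If \<open>b\<close> were nonzero
  throughout \<open>V\<close>, this would contradict its vanishing on the interior.\<close>

lemma minimal_prime_hull_zero_set:
  assumes "zero_dimensional_space X" "almost_P_space X" and a: "a \<in> A"
    and b: "b \<in> minimal_prime_hull R a"
  shows "zero_set X a \<subseteq> zero_set X b"
proof
  fix x assume x: "x \<in> zero_set X a"
  have bA: "b \<in> A" using b by (simp add: minimal_prime_hull_def)
  show "x \<in> zero_set X b"
  proof (rule ccontr)
    assume nx: "x \<notin> zero_set X b"
    have "openin X {y \<in> topspace X. b y \<in> - {0}}"
      using bA subset_Cc by (intro openin_continuous_map_preimage[of _ euclideanreal]) (auto simp: Cc_def)
    moreover have "x \<in> {y \<in> topspace X. b y \<in> - {0}}" using x nx by (auto simp: zero_set_def)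
    ultimately obtain V where V: "openin X V" "closedin X V" "x \<in> V"
      and Vb: "V \<subseteq> {y \<in> topspace X. b y \<in> - {0}}"
      using assms(1) unfolding zero_dimensional_space_def by meson
    \<comment> \<open>Adding the indicator of the complement of \<open>V\<close> to the square of
      \<open>a\<close> cuts the zero set down to its part in \<open>V\<close>. The almost P-property
      applied to \<open>h\<close> then gives an interior point inside \<open>V\<close>.\<close>
    define e where "e = (\<lambda>x\<in>topspace X. if x \<in> topspace X - V then 1 else 0 :: real)"
    have e: "e \<in> A"
      using clopen_indicator_in_Cc_bdd[of X "topspace X - V"] V bdd_subset by (auto simp: e_def closedin_def)
    define h where "h = (\<lambda>y\<in>topspace X. (\<lambda>y\<in>topspace X. a y * a y) y + e y)"
    have hA: "h \<in> A" unfolding h_def by (intro A_add A_mult a e)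
    have hz: "zero_set X h = zero_set X a \<inter> V"
      using Vb by (auto simp: zero_set_def h_def e_def add_nonneg_eq_0_iff)
    have "continuous_map X euclideanreal h" using hA subset_Cc by (auto simp: Cc_def)
    moreover have "zero_set X h \<noteq> {}" using hz x V(3) by auto
    ultimately obtain y where y: "y \<in> X interior_of zero_set X h"
      using assms(2) unfolding almost_P_space_def by blast
    then have "y \<in> V" using hz interior_of_subset by fastforce
    moreover have "y \<in> X interior_of zero_set X a"
      using y interior_of_mono[of "zero_set X h" "zero_set X a" X] hz by blast
    then have "b y = 0" by (rule minimal_prime_hull_vanishes[OF assms(1) a b])
    ultimately show False using Vb by auto
  qed
qed

lemma maximal_hull_zero_set:
  assumes AC: "A = Cc X" and a: "a \<in> A" and b: "b \<in> A" and ab: "zero_set X a \<subseteq> zero_set X b"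
  shows "b \<in> maximal_hull R a"
proof -
  have "b \<in> M" if M: "maximalideal M R" and aM: "a \<in> M" for M
  proof (rule ccontr)
    assume bM: "b \<notin> M"
    interpret M: maximalideal M R by fact
    let ?J = "M <+>\<^bsub>R\<^esub> PIdl\<^bsub>R\<^esub> b"
    have J: "ideal ?J R" "M \<subseteq> ?J" "b \<in> ?J"
      using ideal_adjoin[OF M.ideal_axioms, of b] b by auto
    then have "?J = carrier R"
      using M.I_maximal[OF J(1,2)] bM ideal.Icarr[OF J(1)] by blast
    then obtain m r where m: "m \<in> M" and r: "r \<in> A" and mr: "\<one>\<^bsub>R\<^esub> = m \<oplus>\<^bsub>R\<^esub> r \<otimes>\<^bsub>R\<^esub> b"
      using ideal_adjoin(4)[OF M.ideal_axioms, of b "\<one>\<^bsub>R\<^esub>"] b one_closed by auto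
    \<comment> \<open>A zero of this sum of squares would be a common zero of \<open>a\<close> and
      \<open>m\<close>, hence a zero of \<open>b\<close>, and there \<open>mr\<close> would read
      \<open>1 = 0\<close>.\<close>
    define u where "u = a \<otimes>\<^bsub>R\<^esub> a \<oplus>\<^bsub>R\<^esub> m \<otimes>\<^bsub>R\<^esub> m"
    have uM: "u \<in> M" unfolding u_def
      using aM m M.Icarr by (intro M.a_closed M.I_l_closed) auto
    then have uC: "u \<in> Cc X" using M.Icarr AC by auto
    have u_apply: "u y = a y * a y + m y * m y" if "y \<in> topspace X" for y
      using that by (simp add: u_def)
    have nz: "u y \<noteq> 0" if y: "y \<in> topspace X" for y
    proof
      assume "u y = 0"
      then have "a y = 0" "m y = 0" using u_apply[OF y] by (auto simp: add_nonneg_eq_0_iff)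
      moreover from this have "b y = 0" using ab y by (auto simp: zero_set_def)
      ultimately show False using fun_cong[OF mr, of y] y by simp
    qed
    \<comment> \<open>This reciprocal may be unbounded; its membership in \<open>A\<close> comes
      from \<open>A = Cc X\<close>.\<close>
    have "(\<lambda>y\<in>topspace X. inverse (u y)) \<in> Cc X"
      using uC nz by (intro Cc_compose[where h = inverse]) (auto intro!: continuous_intros)
    then have "(\<lambda>y\<in>topspace X. inverse (u y)) \<otimes>\<^bsub>R\<^esub> u \<in> M"
      using AC by (intro M.I_l_closed[OF uM]) simp
    moreover have "(\<lambda>y\<in>topspace X. inverse (u y)) \<otimes>\<^bsub>R\<^esub> u = \<one>\<^bsub>R\<^esub>"
      using nz by (auto simp: fun_eq_iff)
    ultimately have "\<one>\<^bsub>R\<^esub> \<in> M" by metis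
    then show False using M.one_imp_carrier M.I_notcarr by metis
  qed
  then show ?thesis using b by (auto simp: maximal_hull_def)
qed

text \<open>No minimal prime contains \<open>g\<close>: if \<open>c\<close> times a power of
  \<open>g\<close> is zero, then \<open>c\<close> is zero pointwise, yet \<open>c\<close> lies
  outside the prime. The hull is thus an empty intersection.\<close>

lemma minimal_prime_hull_nonvanishing:
  assumes "g \<in> A" "\<And>x. x \<in> topspace X \<Longrightarrow> g x \<noteq> 0"
  shows "minimal_prime_hull R g = A"
proof -
  have False if P: "minimal_primeideal P R" and gP: "g \<in> P" for P
  proof -
    obtain c n where c: "c \<in> A" "c \<notin> P" "c \<otimes>\<^bsub>R\<^esub> g [^]\<^bsub>R\<^esub> (n::nat) = \<zero>\<^bsub>R\<^esub>"
      using minimal_prime_annihilator[OF P gP] by force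
    have "c x = 0" if "x \<in> topspace X" for x
      using fun_cong[OF c(3), of x] that assms(2)[OF that] by (simp add: power_apply)
    then have "c = \<zero>\<^bsub>R\<^esub>"
      using A_ext[OF c(1)] by (auto intro: extensionalityI)
    interpret P: primeideal P R using P by (simp add: minimal_primeideal_def)
    show False using \<open>c = \<zero>\<^bsub>R\<^esub>\<close> c(2) P.zero_closed by metis
  qed
  then show ?thesis by (auto simp: minimal_prime_hull_def)
qed

lemma maximal_z0_imp_eq_Cc:
  assumes max: "\<And>M. maximalideal M R \<Longrightarrow> z0_ideal M R"
  shows "A = Cc X"
proof
  show "Cc X \<subseteq> A"
  proof
    fix f assume f: "f \<in> Cc X"
    have pos: "1 + t * t > 0" for t :: real by (simp add: add_pos_nonneg)
    let ?g = "\<lambda>x\<in>topspace X. 1 / (1 + f x * f x)"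
    let ?k = "\<lambda>x\<in>topspace X. f x / (1 + f x * f x)"
    have "?g \<in> Cc_bdd X"
    proof (rule Cc_bounded_compose[OF f])
      show "continuous_on UNIV (\<lambda>t::real. 1 / (1 + t * t))"
        by (intro continuous_intros) (use pos in \<open>auto simp: less_imp_neq[symmetric]\<close>)
      show "\<bar>1 / (1 + t * t)\<bar> \<le> 1" for t :: real by (simp add: add_pos_nonneg)
    qed
    then have gA: "?g \<in> A" using bdd_subset by blast
    have "?k \<in> Cc_bdd X"
    proof (rule Cc_bounded_compose[OF f])
      show "continuous_on UNIV (\<lambda>t::real. t / (1 + t * t))"
        by (intro continuous_intros) (use pos in \<open>auto simp: less_imp_neq[symmetric]\<close>)
      show "\<bar>t / (1 + t * t)\<bar> \<le> 1" for t :: real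
      proof -
        \<comment> \<open>Expanding gives \<open>\<bar>t\<bar> \<le> t * t + 1/4\<close>, which is
          more than the bound by 1 requires.\<close>
        have "0 \<le> (\<bar>t\<bar> - 1/2)\<^sup>2" by simp
        then have "\<bar>t\<bar> \<le> 1 + t * t" by (simp add: power2_eq_square algebra_simps)
        then show ?thesis using pos[of t] by (simp add: abs_mult)
      qed
    qed
    then have kA: "?k \<in> A" using bdd_subset by blast
    \<comment> \<open>A maximal ideal containing \<open>?g\<close> would, as a z0-ideal, contain the
      hull of \<open>?g\<close>, which is all of \<open>A\<close>. So \<open>?g\<close> is a unit of
      \<open>A\<close>.\<close>
    have "PIdl\<^bsub>R\<^esub> ?g = carrier R"
    proof (rule ccontr)
      assume "PIdl\<^bsub>R\<^esub> ?g \<noteq> carrier R"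
      then obtain M where M: "maximalideal M R" "PIdl\<^bsub>R\<^esub> ?g \<subseteq> M"
        using maximalideal_exists cgenideal_ideal[of ?g] gA by auto
      then have gM: "?g \<in> M" using cgenideal_self[of ?g] gA by auto
      have "minimal_prime_hull R ?g = A"
        using gA pos by (intro minimal_prime_hull_nonvanishing) (auto simp: less_imp_neq[symmetric])
      moreover have "minimal_prime_hull R ?g \<subseteq> M" "M \<noteq> A"
        using max[OF M(1)] gM by (auto simp: z0_ideal_def)
      moreover have "M \<subseteq> A"
        using ideal.Icarr[OF maximalideal.axioms(1)[OF M(1)]] by auto
      ultimately show False by blast
    qed
    then have "\<one>\<^bsub>R\<^esub> \<in> PIdl\<^bsub>R\<^esub> ?g" using one_closed by blast
    then obtain r where r: "r \<in> A" "\<one>\<^bsub>R\<^esub> = r \<otimes>\<^bsub>R\<^esub> ?g"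
      unfolding cgenideal_def by auto
    \<comment> \<open>The inverse \<open>r\<close> of \<open>?g\<close> equals
      \<open>1 + f x * f x\<close> at each point \<open>x\<close>, so multiplying by it clears the
      denominator of \<open>?k\<close>.\<close>
    have "f = (\<lambda>x\<in>topspace X. ?k x * r x)"
    proof (rule extensionalityI[of _ "topspace X"])
      show "f \<in> extensional (topspace X)" using f by (simp add: Cc_def)
      fix x assume x: "x \<in> topspace X"
      have *: "r x / (1 + f x * f x) = 1" using fun_cong[OF r(2), of x] x by simp
      have "f x = f x * (r x / (1 + f x * f x))" using * by simp
      then show "f x = (\<lambda>x\<in>topspace X. ?k x * r x) x" using x by simp
    qed simp
    then show "f \<in> A" using A_mult[OF kA r(1)] by metis
  qed
qed (rule subset_Cc)

text \<open>Zero sets link the two hulls: a member of the minimal prime hull of \<open>a\<close>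
  vanishes wherever \<open>a\<close> does, and such functions lie in the maximal hull of
  \<open>a\<close>.\<close>

lemma z_imp_z0_ideal:
  assumes "zero_dimensional_space X" "almost_P_space X" "A = Cc X" "z_ideal I R"
  shows "z0_ideal I R"
proof -
  have "minimal_prime_hull R a \<subseteq> maximal_hull R a" if "a \<in> A" for a
    using minimal_prime_hull_zero_set[OF assms(1,2) that] maximal_hull_zero_set[OF assms(3) that]
    by (auto simp: minimal_prime_hull_def)
  then show ?thesis
    using assms(4) ideal.Icarr[of I R] unfolding z_ideal_def z0_ideal_def by fastforce
qed

end

text \<open>For \<open>a \<in> M\<close>, the ideal \<open>M\<close> is itself one of those
  intersected in the maximal hull of \<open>a\<close>.\<close>

lemma maximalideal_imp_z_ideal: "maximalideal M R \<Longrightarrow> z_ideal M R"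
  using maximalideal.axioms(1) maximalideal.I_notcarr
  by (fastforce simp: z_ideal_def maximal_hull_def)

theorem theorem4p12:
  fixes X :: "'a topology" and A :: "('a \<Rightarrow> real) set"
  defines "R \<equiv> (Cc_ring X)\<lparr>carrier := A\<rparr>"
  assumes "zero_dimensional_space X" and "Hausdorff_space X" and "almost_P_space X"
    and "subring A (Cc_ring X)" and "Cc_bdd X \<subseteq> A" and "A \<subseteq> Cc X"
  shows "((\<forall>M. maximalideal M R \<longrightarrow> z0_ideal M R) \<longleftrightarrow> (\<forall>I. z_ideal I R \<longrightarrow> z0_ideal I R))
       \<and> ((\<forall>I. z_ideal I R \<longrightarrow> z0_ideal I R) \<longleftrightarrow> A = Cc X)"
proof -
  interpret I: intermediate_ring X A
    using assms(5-7) by (rule intermediate_ring.intro)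
  show ?thesis
    unfolding R_def
    \<comment> \<open>The implications close a cycle: maximal ideals being z0-ideals gives
      \<open>A = Cc X\<close>, which makes z-ideals z0-ideals, and maximal ideals are
      z-ideals.\<close>
    using I.maximal_z0_imp_eq_Cc I.z_imp_z0_ideal[OF assms(2,4)] maximalideal_imp_z_ideal by blast
qed

end
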